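(* Let $n$ be a natural number with $n\neq 2$ and $n\neq 6$. Then any linear quasigroup over the symmetric group $S_n$ is not orthogonal to its $(12)$-parastrophe.
   Context: A linear quasigroup over a group $(Q,+)$ (written additively, not necessarily commutative) is a quasigroup $(Q,A)$ of the form $A(x,y)=\varphi x+a+\psi y$ with $\varphi,\psi\in Aut(Q,+)$ and a fixed $a\in Q$ (equivalently, of the form $\varphi x+\psi' y+a$ with $\varphi,\psi'\in Aut(Q,+)$). Here $(Q,+)$ is the symmetric group $S_n$. The $(12)$-parastrophe of $A$ is $A^{(12)}(x,y)=A(y,x)$. Two quasigroup operations $A,B$ on $Q$ are orthogonal if for all $a,b\in Q$ the system $A(x,y)=a$, $B(x,y)=b$ has a unique solution $(x,y)\in Q\times Q$.
   Formalization: The hypothesis n ≥ 2 is added: for n = 0 and n = 1 the group S_n is trivial, and its only linear quasigroup is orthogonal to its (12)-parastrophe, so the claim fails there. *)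

theory Defs
  imports "HOL-Algebra.Algebra"
begin

text \<open>A binary operation on a set \<open>Q\<close> is a total function of the ambient type; only its values
  on \<open>Q \<times> Q\<close> matter, and every condition below is relativised to \<open>Q\<close>.\<close>

definition quasigroup :: "'a set \<Rightarrow> ('a \<Rightarrow> 'a \<Rightarrow> 'a) \<Rightarrow> bool" where
  "quasigroup Q A \<longleftrightarrow>
     (\<forall>x\<in>Q. \<forall>y\<in>Q. A x y \<in> Q) \<and>
     (\<forall>a\<in>Q. \<forall>b\<in>Q. \<exists>!x. x \<in> Q \<and> A x a = b) \<and>
     (\<forall>a\<in>Q. \<forall>b\<in>Q. \<exists>!y. y \<in> Q \<and> A a y = b)"

text \<open>The group is written multiplicatively, so \<open>\<phi> x + a + \<psi> y\<close> becomes
  \<open>\<phi> x \<otimes> a \<otimes> \<psi> y\<close>. The set \<^term>\<open>auto G\<close> consists of the automorphisms of \<open>G\<close>.\<close>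

definition linear_quasigroup :: "('a, 'b) monoid_scheme \<Rightarrow> ('a \<Rightarrow> 'a \<Rightarrow> 'a) \<Rightarrow> bool" where
  "linear_quasigroup G A \<longleftrightarrow>
     quasigroup (carrier G) A \<and>
     (\<exists>\<phi>\<in>auto G. \<exists>\<psi>\<in>auto G. \<exists>a\<in>carrier G.
        \<forall>x\<in>carrier G. \<forall>y\<in>carrier G. A x y = \<phi> x \<otimes>\<^bsub>G\<^esub> a \<otimes>\<^bsub>G\<^esub> \<psi> y)"

definition parastrophe12 :: "('a \<Rightarrow> 'a \<Rightarrow> 'a) \<Rightarrow> 'a \<Rightarrow> 'a \<Rightarrow> 'a" where
  "parastrophe12 A = (\<lambda>x y. A y x)"

definition orthogonal_on :: "'a set \<Rightarrow> ('a \<Rightarrow> 'a \<Rightarrow> 'a) \<Rightarrow> ('a \<Rightarrow> 'a \<Rightarrow> 'a) \<Rightarrow> bool" where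
  "orthogonal_on Q A B \<longleftrightarrow>
     (\<forall>a\<in>Q. \<forall>b\<in>Q. \<exists>!p. p \<in> Q \<times> Q \<and> A (fst p) (snd p) = a \<and> B (fst p) (snd p) = b)"

end

theory Submission
  imports Defs
begin

text \<open>A homomorphism from the symmetric group to \<open>{-1, 1}\<close> is trivial on
  3-cycles, which have order 3, and hence on the alternating group they generate. Therefore every
  automorphism preserves the alternating group, that is, the sign. Hence
  \<open>A x y = \<phi> x \<otimes> a \<otimes> \<psi> y\<close> and \<open>A y x\<close> always have the same sign, so the
  system \<open>A x y = u\<close>, \<open>A y x = v\<close> is unsolvable as soon as \<open>u\<close> and \<open>v\<close> have
  opposite signs.\<close>

lemma three_cycle_cubed:
  assumes "c \<in> three_cycles n"
  shows "c \<circ> c \<circ> c = id"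
proof -
  obtain cs where cs: "c = cycle_of_list cs" "cycle cs" "length cs = 3"
    using assms by auto
  obtain i j k where "cs = [i, j, k]"
    using stupid_lemma[OF cs(3)] by blast
  \<comment> \<open>\<open>c\<close> unfolds to the product of the transpositions
    \<open>(i j)\<close> and \<open>(j k)\<close>; with \<open>i\<close>, \<open>j\<close>,
    \<open>k\<close> distinct, a pointwise case check suffices.\<close>
  then show ?thesis
    using cs by (auto simp: fun_eq_iff transpose_def)
qed

lemma hom_sign_img_alt_group:
  assumes hom: "\<chi> \<in> hom (sym_group n) sign_img" and p: "p \<in> carrier (alt_group n)"
  shows "\<chi> p = 1"
proof -
  interpret group_hom "sym_group n" sign_img \<chi>
    using hom by (intro group_hom.intro sym_group_is_group sign_img_is_group group_hom_axioms.intro)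
  have "three_cycles n \<subseteq> kernel (sym_group n) sign_img \<chi>"
  proof
    fix c assume c: "c \<in> three_cycles n"
    then have "c \<in> carrier (alt_group n)"
      using three_cycles_incl by blast
    then have carr: "c \<in> carrier (sym_group n)"
      by (simp add: alt_group_carrier sym_group_carrier)
    then have "\<chi> (c \<circ> c \<circ> c) = \<chi> c * \<chi> c * \<chi> c"
      using hom_mult[of c c] hom_mult[of "c \<circ> c" c] G.m_closed[of c c]
      by (simp add: sym_group_mult sign_img_def)
    moreover have "\<chi> id = 1"
      using hom_one by (simp add: sym_group_one sign_img_def)
    moreover have "\<chi> c \<in> {-1, 1}"
      using hom_closed[OF carr] by (simp add: sign_img_def)
    \<comment> \<open>Both elements of {-1, 1} equal their own cubes, so \<open>\<chi> c\<close> is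
      the value of \<open>\<chi>\<close> at the cube of \<open>c\<close>, which is
      \<open>id\<close>.\<close>
    ultimately have "\<chi> c = 1"
      using three_cycle_cubed[OF c] by auto
    then show "c \<in> kernel (sym_group n) sign_img \<chi>"
      using carr by (simp add: kernel_def sign_img_def)
  qed
  then have "generate (sym_group n) (three_cycles n) \<subseteq> kernel (sym_group n) sign_img \<chi>"
    by (rule G.generate_subgroup_incl[OF _ subgroup_kernel])
  \<comment> \<open>Generation by 3-cycles is known inside \<open>alt_group n\<close>; it is moved
    to \<open>sym_group n\<close>, where the kernel lives.\<close>
  moreover have "carrier (alt_group n) = generate (sym_group n) (three_cycles n)"
    using G.generate_consistent[OF three_cycles_incl alt_group_is_subgroup]
      alt_group_carrier_as_three_cycles[of n]
    by (simp add: alt_group_def)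
  ultimately show ?thesis
    using p by (auto simp: kernel_def sign_img_def)
qed

lemma sign_eq_1_iff_alt_group:
  assumes "p \<in> carrier (sym_group n)"
  shows "sign p = 1 \<longleftrightarrow> p \<in> carrier (alt_group n)"
  using assms by (simp add: alt_group_carrier sym_group_carrier sign_def)

text \<open>Composing \<open>\<phi>\<close> with \<open>sign\<close> gives another homomorphism into
  \<open>sign_img\<close>, which is trivial on even permutations by
  \<open>hom_sign_img_alt_group\<close>.\<close>

lemma sign_auto:
  assumes \<phi>: "\<phi> \<in> auto (sym_group n)" and p: "p \<in> carrier (sym_group n)"
  shows "sign (\<phi> p) = sign p"
proof -
  let ?S = "carrier (sym_group n)" and ?A = "carrier (alt_group n)"
  have hom: "\<phi> \<in> hom (sym_group n) (sym_group n)" and bij: "bij_betw \<phi> ?S ?S"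
    using \<phi> by (auto simp: auto_def Bij_def)
  have sub: "?A \<subseteq> ?S"
    by (auto simp: alt_group_carrier sym_group_carrier)
  have "sign \<circ> \<phi> \<in> hom (sym_group n) sign_img"
    using hom_compose[OF hom sign_is_hom] .
  then have "sign (\<phi> q) = 1" if "q \<in> ?A" for q
    using hom_sign_img_alt_group that by fastforce
  then have "\<phi> ` ?A \<subseteq> ?A"
    using sign_eq_1_iff_alt_group sub hom_in_carrier[OF hom] by blast
  \<comment> \<open>The inclusion only keeps even permutations even. Finiteness and injectivity turn
    it into an equality, so odd ones stay odd.\<close>
  moreover have "finite ?A"
    by (rule finite_subset[OF _ finite_permutations[of "{1..n}"]]) (auto simp: alt_group_carrier)
  ultimately have "\<phi> ` ?A = ?A"
    using bij sub by (intro endo_inj_surj) (auto simp: bij_betw_def intro: inj_on_subset)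
  then have "\<phi> p \<in> ?A \<longleftrightarrow> p \<in> ?A"
    using inj_on_image_mem_iff[OF bij_betw_imp_inj_on[OF bij] p sub] by simp
  then have "sign (\<phi> p) = 1 \<longleftrightarrow> sign p = 1"
    using p hom_in_carrier[OF hom p] sign_eq_1_iff_alt_group by blast
  then show ?thesis
    by (simp add: sign_def split: if_splits)
qed

text \<open>Signs multiply and automorphisms preserve them, so \<open>A x y\<close> has sign
  \<open>sign x * sign a * sign y\<close>, which is symmetric in \<open>x\<close> and
  \<open>y\<close>.\<close>

lemma sign_linear_quasigroup_commute:
  assumes "linear_quasigroup (sym_group n) A"
    and x: "x \<in> carrier (sym_group n)" and y: "y \<in> carrier (sym_group n)"
  shows "sign (A x y) = sign (A y x)"
proof -
  obtain \<phi> \<psi> a where auto: "\<phi> \<in> auto (sym_group n)" "\<psi> \<in> auto (sym_group n)"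
    and a: "a \<in> carrier (sym_group n)"
    and A: "\<And>x y. x \<in> carrier (sym_group n) \<Longrightarrow> y \<in> carrier (sym_group n) \<Longrightarrow> A x y = \<phi> x \<circ> a \<circ> \<psi> y"
    using assms(1) unfolding linear_quasigroup_def sym_group_mult by blast
  \<comment> \<open>Multiplicativity of \<open>sign\<close> holds for permutations of finite
    support.\<close>
  have perm: "permutation (\<phi> z)" "permutation (\<psi> z)" if "z \<in> carrier (sym_group n)" for z
    using auto that by (auto simp: auto_def hom_def intro!: sym_group_carrier'[of _ n])
  have "sign (A x y) = sign x * sign a * sign y"
    if "x \<in> carrier (sym_group n)" "y \<in> carrier (sym_group n)" for x y
    using that auto by (simp add: A sign_compose permutation_compose perm sym_group_carrier'[OF a] sign_auto)
  with x y show ?thesis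
    by simp
qed

theorem corollary49:
  fixes n :: nat and A :: "(nat \<Rightarrow> nat) \<Rightarrow> (nat \<Rightarrow> nat) \<Rightarrow> (nat \<Rightarrow> nat)"
  assumes "n \<ge> 2" and "n \<noteq> 2" and "n \<noteq> 6"
    and "linear_quasigroup (sym_group n) A"
  shows "\<not> orthogonal_on (carrier (sym_group n)) A (parastrophe12 A)"
proof
  assume orth: "orthogonal_on (carrier (sym_group n)) A (parastrophe12 A)"
  \<comment> \<open>The even \<open>id\<close> and the odd \<open>?t\<close> serve as right-hand
    sides of opposite sign; 2 \<le> n puts both moved points in \<open>{1..n}\<close>.\<close>
  let ?t = "transpose 1 2 :: nat \<Rightarrow> nat"
  have "id \<in> carrier (sym_group n)" "?t \<in> carrier (sym_group n)"
    using \<open>n \<ge> 2\<close> by (auto simp: sym_group_carrier permutes_id intro!: permutes_swap_id)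
  then obtain x y where "x \<in> carrier (sym_group n)" "y \<in> carrier (sym_group n)"
    and "A x y = id" "A y x = ?t"
    using orth unfolding orthogonal_on_def parastrophe12_def by (metis mem_Times_iff)
  then have "sign (id :: nat \<Rightarrow> nat) = sign ?t"
    using sign_linear_quasigroup_commute[OF assms(4)] by metis
  then show False
    by (simp add: sign_swap_id)
qed

end
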